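(* Let $\mathcal{M}$ be a matroid on a set $E$, let $(S,T,C_1,\ldots,C_k)$ be an ordered partition of $E$ into pairwise disjoint nonempty subsets, and fix nonnegative integers $c_1,\ldots,c_k$. For each $0\le j\le|S|$ let $M_j(\mathbf{y}):=\sum_B\prod_{e\in B}y_e$, the sum over all bases $B$ of $\mathcal{M}$ with $|B\cap S|=j$ and $|B\cap C_i|=c_i$ for all $1\le i\le k$. If $\mathcal{M}$ is an HPP matroid and $y_e>0$ for all $e\in E$, then the polynomial $\sum_{j=0}^{|S|}M_j(\mathbf{y})x^j$ in the variable $x$ has only real zeros.
   Context: A polynomial $P(\mathbf{y})$ in complex variables $\mathbf{y}=\{y_e:e\in E\}$ has the half-plane property if $P(\mathbf{y})\neq0$ whenever $\mathrm{Re}(y_e)>0$ for all $e\in E$. A matroid $\mathcal{M}$ on $E$ is an HPP (half-plane property) matroid if its basis-generating polynomial $M(\mathbf{y})=\sum_{B}\prod_{e\in B}y_e$ (sum over all bases $B$) has the half-plane property. *)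

theory Defs
  imports "HOL-Library.Disjoint_Sets" "HOL-Computational_Algebra.Polynomial" Complex_Main
begin

text \<open>A matroid on a finite ground set \<open>E\<close>, given by its collection \<open>\<B>\<close> of bases.\<close>

locale matroid =
  fixes E :: "'a set" and \<B> :: "'a set set"
  assumes finite_ground: "finite E"
    and basis_subset: "\<And>B. B \<in> \<B> \<Longrightarrow> B \<subseteq> E"
    and bases_nonempty: "\<B> \<noteq> {}"
    and basis_exchange:
      "\<And>A B a. \<lbrakk>A \<in> \<B>; B \<in> \<B>; a \<in> A - B\<rbrakk> \<Longrightarrow> \<exists>b \<in> B - A. insert b (A - {a}) \<in> \<B>"

text \<open>Polynomials in the variables \<open>y\<^sub>e\<close> are represented by their evaluation maps;
  the variables are indexed by the whole type, but only those in \<open>E\<close> occur.\<close>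

definition half_plane_property :: "'a set \<Rightarrow> (('a \<Rightarrow> complex) \<Rightarrow> complex) \<Rightarrow> bool" where
  "half_plane_property E P \<longleftrightarrow> (\<forall>y. (\<forall>e\<in>E. Re (y e) > 0) \<longrightarrow> P y \<noteq> 0)"

definition generating_poly :: "'a set set \<Rightarrow> ('a \<Rightarrow> 'b::comm_semiring_1) \<Rightarrow> 'b" where
  "generating_poly \<B> y = (\<Sum>B\<in>\<B>. \<Prod>e\<in>B. y e)"

definition HPP_matroid :: "'a set \<Rightarrow> 'a set set \<Rightarrow> bool" where
  "HPP_matroid E \<B> \<longleftrightarrow> matroid E \<B> \<and> half_plane_property E (generating_poly \<B>)"

definition ordered_partition :: "'a set \<Rightarrow> 'a set list \<Rightarrow> bool" where
  "ordered_partition E As \<longleftrightarrow> distinct As \<and> partition_on E (set As)"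

definition constrained_poly ::
    "'a set set \<Rightarrow> 'a set \<Rightarrow> nat \<Rightarrow> (nat \<Rightarrow> 'a set) \<Rightarrow> (nat \<Rightarrow> nat) \<Rightarrow> nat \<Rightarrow>
      ('a \<Rightarrow> 'b::comm_semiring_1) \<Rightarrow> 'b" where
  "constrained_poly \<B> S k C c j =
     generating_poly {B \<in> \<B>. card (B \<inter> S) = j \<and> (\<forall>i\<in>{1..k}. card (B \<inter> C i) = c i)}"

text \<open>All complex zeros are real. The zero polynomial counts as having only real zeros,
  as is customary for statements of this kind.\<close>

definition only_real_zeros :: "real poly \<Rightarrow> bool" where
  "only_real_zeros p \<longleftrightarrow>
     p = 0 \<or> (\<forall>z::complex. poly (map_poly complex_of_real p) z = 0 \<longrightarrow> z \<in> \<real>)"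

end

theory Submission
  imports Defs "HOL-Complex_Analysis.Great_Picard"
    "HOL-Computational_Algebra.Fundamental_Theorem_Algebra"
begin

text \<open>Scale the variables of each block \<open>X\<close> of the partition by a common factor \<open>u\<^sub>X\<close>. The
  generating polynomial becomes a polynomial in \<open>u\<close> with positive coefficients and the half-plane
  property. Extracting the coefficient of \<open>u\<^sub>X\<^sup>c\<close> preserves that property: it is
  differentiation (the Gauss--Lucas argument) followed by letting \<open>u\<^sub>X\<close> tend to 0 (Hurwitz' theorem),
  where positivity of the coefficients excludes a limit that vanishes identically. Extracting the coefficients for
  \<open>C\<^sub>1, \<dots>, C\<^sub>k\<close> and setting these variables to 1 leaves a homogeneous polynomial in \<open>u\<^sub>S\<close>
  and \<open>u\<^sub>T\<close>; if \<open>x\<close> is not real, then some rotation \<open>\<mu>\<close> moves both \<open>\<mu>x\<close> and \<open>\<mu>\<close> into the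
  right half-plane, so \<open>x\<close> is not a zero.\<close>

section \<open>Polynomials with labelled terms\<close>

text \<open>Terms are indexed by labels \<open>B\<close> (later bases) with exponents
  \<open>m B\<close>, and distinct labels may share a monomial. Extracting a coefficient is thus
  just filtering \<open>A\<close>.\<close>

definition posynomial ::
    "'i set \<Rightarrow> 'b set \<Rightarrow> ('b \<Rightarrow> real) \<Rightarrow> ('b \<Rightarrow> 'i \<Rightarrow> nat) \<Rightarrow> ('i \<Rightarrow> complex) \<Rightarrow> complex" where
  "posynomial I A a m u = (\<Sum>B\<in>A. of_real (a B) * (\<Prod>i\<in>I. u i ^ m B i))"

lemma posynomial_split:
  assumes "finite I" "l \<in> I"
  shows "posynomial I A a m u =
    (\<Sum>B\<in>A. of_real (a B) * (\<Prod>i\<in>I - {l}. u i ^ m B i) * u l ^ m B l)"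
  unfolding posynomial_def
  by (rule sum.cong) (auto simp: prod.remove[OF assms] ac_simps)

lemma posynomial_one_pos:
  assumes "finite A" "A \<noteq> {}" "\<And>B. B \<in> A \<Longrightarrow> a B > 0"
  shows "posynomial I A a m (\<lambda>_. 1) \<noteq> 0"
proof -
  have "posynomial I A a m (\<lambda>_. 1) = of_real (\<Sum>B\<in>A. a B)"
    by (simp add: posynomial_def)
  moreover have "(\<Sum>B\<in>A. a B) > 0"
    using assms by (intro sum_pos) auto
  ultimately show ?thesis by (metis less_irrefl of_real_eq_0_iff)
qed

lemma half_plane_propertyD:
  "half_plane_property E P \<Longrightarrow> (\<And>e. e \<in> E \<Longrightarrow> Re (y e) > 0) \<Longrightarrow> P y \<noteq> 0"
  by (auto simp: half_plane_property_def)

lemma uniform_limit_sum_finite: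
  fixes f :: "'i \<Rightarrow> 'n \<Rightarrow> 'x \<Rightarrow> 'b::real_normed_vector"
  assumes "finite A" "\<And>i. i \<in> A \<Longrightarrow> uniform_limit K (f i) (g i) F"
  shows "uniform_limit K (\<lambda>n x. \<Sum>i\<in>A. f i n x) (\<lambda>x. \<Sum>i\<in>A. g i x) F"
  using assms by (induction rule: finite_induct) (auto intro!: uniform_limit_intros)

section \<open>Extreme coefficients in one variable\<close>

text \<open>Restricted to a complex line through the all-ones point and a supposed zero
  \<open>u\<close>, the limit as \<open>u l\<close> tends to 0 is a one-variable function. By
  Hurwitz it is zero-free unless constant, and it is not constant: it is positive at the all-ones
  point and zero at \<open>u\<close>.\<close>

lemma half_plane_posynomial_at_zero:
  assumes I: "finite I" "l \<in> I" and A: "finite A" and pos: "\<And>B. B \<in> A \<Longrightarrow> a B > 0"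
    and hpp: "half_plane_property I (posynomial I A a m)"
    and ne: "{B \<in> A. m B l = 0} \<noteq> {}"
  shows "half_plane_property I (posynomial I {B \<in> A. m B l = 0} a m)"
  unfolding half_plane_property_def
proof (intro allI impI notI)
  let ?A = "{B \<in> A. m B l = 0}"
  fix u :: "'a \<Rightarrow> complex"
  assume u: "\<forall>e\<in>I. Re (u e) > 0" and zero: "posynomial I ?A a m u = 0"
  \<comment> \<open>The line has the all-ones point at \<open>s = 0\<close> and \<open>u\<close> at
    \<open>s = 1\<close>; \<open>S\<close> is the set of parameters at which all its coordinates lie
    in the right half-plane.\<close>
  define w where "w s i = 1 + s * (u i - 1)" for s :: complex and i
  define S where "S = (\<Inter>i\<in>I. {s. Re (w s i) > 0})"
  define h where "h B s = of_real (a B) * (\<Prod>i\<in>I - {l}. w s i ^ m B i)" for B s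
  define z where "z n = inverse (of_nat (Suc n) :: complex)" for n
  have Re_z: "Re (z n) > 0" for n
  proof -
    have "z n = of_real (inverse (real (Suc n)))"
      unfolding z_def by (simp only: of_real_inverse of_real_of_nat_eq)
    then have "Re (z n) = inverse (real (Suc n))" by (simp only: Re_complex_of_real)
    then show ?thesis by simp
  qed
  define F where "F n s = (\<Sum>B\<in>A. h B s * z n ^ m B l)" for n s
  define G where "G s = (\<Sum>B\<in>A. h B s * (if m B l = 0 then 1 else 0))" for s
  have w: "w 0 = (\<lambda>_. 1)" "w 1 = u" by (simp_all add: fun_eq_iff w_def)
  have G_eq: "G s = posynomial I ?A a m (w s)" for s
  proof -
    have "G s = (\<Sum>B\<in>?A. h B s)"
      unfolding G_def using A by (simp add: if_distrib sum.If_cases Int_def cong: if_cong)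
    then show ?thesis
      unfolding posynomial_split[OF I] h_def by (simp add: h_def)
  qed
  have hol_h: "h B holomorphic_on X" for B X
    unfolding h_def[abs_def] w_def by (intro holomorphic_intros)
  have "open S"
    unfolding S_def w_def using I
    by (intro open_INT ballI open_Collect_less) (auto intro!: continuous_intros)
  moreover have "convex S"
  proof -
    have "convex {s. Re (w s i) > 0}" for i
    proof -
      have "{s. Re (w s i) > 0} = {s. inner (cnj (u i - 1)) s > -1}"
        by (auto simp: w_def inner_complex_def algebra_simps)
      then show ?thesis by (simp add: convex_halfspace_gt)
    qed
    then show ?thesis unfolding S_def by (intro convex_INT) auto
  qed
  ultimately have S: "open S" "connected S" by (auto intro: convex_connected)
  have "G 1 \<noteq> 0"
  proof (rule Hurwitz_no_zeros[OF S, of F G])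
    show "F n holomorphic_on S" for n
      unfolding F_def by (intro holomorphic_intros hol_h)
    show "G holomorphic_on S"
      unfolding G_def by (intro holomorphic_intros hol_h)
    show "uniform_limit K F G sequentially" if "compact K" "K \<subseteq> S" for K
    proof -
      have "(\<lambda>n. z n ^ m B l) \<longlonglongrightarrow> (if m B l = 0 then 1 else 0)" for B
      proof -
        have "z \<longlonglongrightarrow> 0" unfolding z_def by (intro LIMSEQ_Suc lim_inverse_n)
        \<comment> \<open>The convention \<open>0 ^ 0 = 1\<close> makes the limit select exactly the
          terms free of \<open>u l\<close>.\<close>
        then have "(\<lambda>n. z n ^ m B l) \<longlonglongrightarrow> 0 ^ m B l" by (intro tendsto_intros)
        then show ?thesis by (simp add: power_0_left)
      qed
      then have lim: "uniform_limit K (\<lambda>n s. z n ^ m B l) (\<lambda>s. if m B l = 0 then 1 else 0) sequentially"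
        for B
        by (auto simp: uniform_limit_iff tendsto_iff elim: eventually_mono)
      have bdd: "bounded (h B ` K)" for B
        using compact_continuous_image[OF holomorphic_on_imp_continuous_on[OF hol_h] that(1)]
        by (simp add: compact_imp_bounded)
      have "uniform_limit K (\<lambda>n s. \<Sum>B\<in>A. h B s * z n ^ m B l)
             (\<lambda>s. \<Sum>B\<in>A. h B s * (if m B l = 0 then 1 else 0)) sequentially"
        by (intro uniform_limit_sum_finite A uniform_lim_mult lim uniform_limit_const bdd)
           (auto intro: finite_subset[of _ "{0,1}"])
      then show ?thesis unfolding F_def[abs_def] G_def[abs_def] .
    qed
    show "\<not> G constant_on S"
    proof
      assume "G constant_on S"
      moreover have "0 \<in> S" "1 \<in> S" using u by (auto simp: S_def w_def)
      ultimately have "G 0 = G 1" by (metis constant_on_def)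
      also have "\<dots> = 0" using zero by (simp add: G_eq w)
      finally show False
        using posynomial_one_pos[of ?A a I m] A ne pos by (simp add: G_eq w)
    qed
    show "F n s \<noteq> 0" if "s \<in> S" for n s
    proof -
      have "F n s = posynomial I A a m ((w s)(l := z n))"
        unfolding posynomial_split[OF I] F_def h_def by simp
      also have "\<dots> \<noteq> 0"
        using that by (intro half_plane_propertyD[OF hpp])
          (auto simp: S_def Re_z)
      finally show ?thesis .
    qed
    show "1 \<in> S" using u by (auto simp: S_def w_def)
  qed
  then show False using zero by (simp add: G_eq w)
qed

lemma Re_inverse_pos: "Re z > 0 \<Longrightarrow> Re (inverse z) > 0"
  by (cases "z = 0") (auto simp: add_pos_nonneg)

text \<open>The substitution \<open>u\<^sub>l \<mapsto> 1/u\<^sub>l\<close> preserves the right half-plane and turns the leading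
  coefficient into the constant one.\<close>

lemma half_plane_posynomial_leading:
  assumes I: "finite I" "l \<in> I" and A: "finite A" and pos: "\<And>B. B \<in> A \<Longrightarrow> a B > 0"
    and hpp: "half_plane_property I (posynomial I A a m)"
    and le: "\<And>B. B \<in> A \<Longrightarrow> m B l \<le> D" and ne: "{B \<in> A. m B l = D} \<noteq> {}"
  shows "half_plane_property I (posynomial I {B \<in> A. m B l = D} a m)"
proof -
  define m' where "m' B = (m B)(l := D - m B l)" for B
  have "half_plane_property I (posynomial I A a m')"
    unfolding half_plane_property_def
  proof (intro allI impI)
    fix u :: "'a \<Rightarrow> complex" assume u: "\<forall>e\<in>I. Re (u e) > 0"
    then have ul: "u l \<noteq> 0" using I by force
    \<comment> \<open>The factor \<open>u l ^ D\<close> clears denominators; \<open>le\<close>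
      ensures that \<open>D - m B l\<close> is not truncated.\<close>
    have "posynomial I A a m' u = u l ^ D * posynomial I A a m (u(l := inverse (u l)))"
      unfolding posynomial_split[OF I] sum_distrib_left m'_def using ul le
      by (intro sum.cong) (auto simp: power_diff field_simps)
    moreover have "posynomial I A a m (u(l := inverse (u l))) \<noteq> 0"
      using u I by (intro half_plane_propertyD[OF hpp]) (auto simp: Re_inverse_pos simp del: inverse_complex.sel)
    ultimately show "posynomial I A a m' u \<noteq> 0" using ul by simp
  qed
  moreover have eq: "{B \<in> A. m' B l = 0} = {B \<in> A. m B l = D}"
    using le by (force simp: m'_def)
  ultimately have hpp': "half_plane_property I (posynomial I {B \<in> A. m B l = D} a m')"
    using half_plane_posynomial_at_zero[OF I A, of a m'] ne pos by auto
  show ?thesis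
    unfolding half_plane_property_def
  proof (intro allI impI)
    fix u :: "'a \<Rightarrow> complex" assume u: "\<forall>e\<in>I. Re (u e) > 0"
    then have ul: "u l \<noteq> 0" using I by force
    have "posynomial I {B \<in> A. m B l = D} a m u = u l ^ D * posynomial I {B \<in> A. m B l = D} a m' u"
      unfolding posynomial_split[OF I] sum_distrib_left m'_def
      by (intro sum.cong) auto
    then show "posynomial I {B \<in> A. m B l = D} a m u \<noteq> 0"
      using ul u half_plane_propertyD[OF hpp'] by auto
  qed
qed

section \<open>Derivatives and arbitrary coefficients\<close>

text \<open>The logarithmic derivative is the sum of \<open>inverse (z - r)\<close> over the roots
  \<open>r\<close>, with multiplicity. All roots have nonpositive real part, so each summand has
  positive real part. The induction splits off one root at a time.\<close>

lemma Re_log_deriv_pos: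
  fixes p :: "complex poly"
  assumes "\<And>z. Re z > 0 \<Longrightarrow> poly p z \<noteq> 0" "degree p > 0" "Re z > 0"
  shows "Re (poly (pderiv p) z / poly p z) > 0"
  using assms(1,2)
proof (induction "degree p" arbitrary: p)
  case (Suc n)
  obtain r where r: "poly p r = 0"
    using Suc.hyps(2) by (metis constant_degree nat.distinct(1) fundamental_theorem_of_algebra)
  then obtain q where pq: "p = [:-r, 1:] * q"
    by (meson dvdE poly_eq_0_iff_dvd)
  have q0: "poly q z \<noteq> 0" if "Re z > 0" for z
    using Suc.prems(1)[OF that] by (auto simp: pq)
  have "Re r \<le> 0" using Suc.prems(1)[of r] r by force
  then have pos: "Re (inverse (z - r)) > 0"
    using assms(3) by (intro Re_inverse_pos) auto
  have "q \<noteq> 0" using q0[OF assms(3)] by auto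
  then have deg: "degree p = Suc (degree q)"
    unfolding pq by (subst degree_mult_eq) auto
  have "z \<noteq> r" using pos by auto
  have pz: "poly p z = (z - r) * poly q z"
    by (simp add: pq algebra_simps)
  have dp: "poly (pderiv p) z = poly q z + (z - r) * poly (pderiv q) z"
    unfolding pq pderiv_mult by (simp add: pderiv_pCons algebra_simps)
  have quot: "(c + w * d) / (w * c) = inverse w + d / c" if "w \<noteq> 0" "c \<noteq> 0" for c d w :: complex
    using that by (simp add: field_simps)
  have "poly (pderiv p) z / poly p z = inverse (z - r) + poly (pderiv q) z / poly q z"
    unfolding dp pz using q0[OF assms(3)] \<open>z \<noteq> r\<close> by (intro quot) auto
  moreover have "Re (poly (pderiv q) z / poly q z) \<ge> 0"
  proof (cases "degree q = 0")
    case True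
    then have "pderiv q = 0" by (simp add: pderiv_eq_0_iff)
    then show ?thesis by simp
  next
    case False
    then show ?thesis using Suc.hyps(1)[of q] Suc.hyps(2) q0 deg by force
  qed
  ultimately show ?case using pos by (simp del: inverse_complex.sel)
qed simp

text \<open>Gauss-Lucas in the variable \<open>u l\<close> with the others frozen: the logarithmic
  derivative has positive real part, so the derivative cannot vanish.\<close>

lemma half_plane_posynomial_deriv:
  assumes I: "finite I" "l \<in> I" and A: "finite A" and pos: "\<And>B. B \<in> A \<Longrightarrow> a B > 0"
    and hpp: "half_plane_property I (posynomial I A a m)"
    and ne: "{B \<in> A. m B l > 0} \<noteq> {}"
  shows "half_plane_property I
    (posynomial I {B \<in> A. m B l > 0} (\<lambda>B. a B * m B l) (\<lambda>B. (m B)(l := m B l - 1)))"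
  unfolding half_plane_property_def
proof (intro allI impI)
  fix u :: "'a \<Rightarrow> complex" assume u: "\<forall>e\<in>I. Re (u e) > 0"
  define h where "h B = of_real (a B) * (\<Prod>i\<in>I - {l}. u i ^ m B i)" for B
  define q where "q = (\<Sum>B\<in>A. monom (h B) (m B l))"
  define D where "D = Max ((\<lambda>B. m B l) ` A)"
  have A_ne: "A \<noteq> {}" using ne by auto
  have le: "m B l \<le> D" if "B \<in> A" for B using that A by (simp add: D_def)
  have D0: "D > 0" using ne le by force
  have "D \<in> (\<lambda>B. m B l) ` A" unfolding D_def using A A_ne by (intro Max_in) auto
  \<comment> \<open>Freezing the other variables could lower the degree of \<open>q\<close>. The
    leading coefficient inherits the half-plane property, so it does not vanish at \<open>u\<close>,
    and \<open>q\<close> is not constant.\<close>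
  then have "half_plane_property I (posynomial I {B \<in> A. m B l = D} a m)"
    by (intro half_plane_posynomial_leading[OF I A] pos hpp le) auto
  then have "posynomial I {B \<in> A. m B l = D} a m u \<noteq> 0"
    using u by (intro half_plane_propertyD) auto
  moreover have "posynomial I {B \<in> A. m B l = D} a m u = u l ^ D * coeff q D"
    unfolding posynomial_split[OF I] q_def coeff_sum coeff_monom h_def[symmetric]
    using A by (auto simp: sum.If_cases Int_def sum_distrib_left ac_simps intro!: sum.cong)
  ultimately have "coeff q D \<noteq> 0" by auto
  then have deg: "degree q > 0" using D0 le_degree by fastforce
  have poly_q: "poly q z = posynomial I A a m (u(l := z))" for z
    unfolding posynomial_split[OF I] by (simp add: q_def h_def poly_sum poly_monom)
  have "poly q z \<noteq> 0" if "Re z > 0" for z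
    unfolding poly_q using u that by (intro half_plane_propertyD[OF hpp]) auto
  from Re_log_deriv_pos[OF this deg, of "u l"] have "poly (pderiv q) (u l) \<noteq> 0"
    using u I by auto
  moreover have "poly (pderiv q) (u l) = posynomial I {B \<in> A. m B l > 0}
      (\<lambda>B. a B * m B l) (\<lambda>B. (m B)(l := m B l - 1)) u"
  proof -
    have "poly (pderiv q) (u l) = (\<Sum>B\<in>A. h B * of_nat (m B l) * u l ^ (m B l - 1))"
      by (simp add: q_def higher_pderiv_sum[of 1, simplified] poly_sum pderiv_monom poly_monom ac_simps)
    also have "\<dots> = (\<Sum>B\<in>{B \<in> A. m B l > 0}. h B * of_nat (m B l) * u l ^ (m B l - 1))"
      by (rule sum.mono_neutral_right) (use A in auto)
    also have "\<dots> = posynomial I {B \<in> A. m B l > 0}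
      (\<lambda>B. a B * m B l) (\<lambda>B. (m B)(l := m B l - 1)) u"
      unfolding posynomial_split[OF I] h_def by (intro sum.cong) (auto simp: ac_simps)
    finally show ?thesis .
  qed
  ultimately show "posynomial I {B \<in> A. m B l > 0}
      (\<lambda>B. a B * m B l) (\<lambda>B. (m B)(l := m B l - 1)) u \<noteq> 0" by simp
qed

text \<open>Up to the factor \<open>Suc c\<close>, the coefficient at exponent \<open>Suc c\<close>
  is the coefficient at exponent \<open>c\<close> of the derivative in \<open>u l\<close>.
  Differentiating changes \<open>A\<close>, \<open>a\<close> and \<open>m\<close>, so the induction
  generalizes all three.\<close>

lemma half_plane_posynomial_coeff:
  assumes I: "finite I" "l \<in> I" and "finite A" and "\<And>B. B \<in> A \<Longrightarrow> a B > 0"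
    and "half_plane_property I (posynomial I A a m)"
    and "{B \<in> A. m B l = c} \<noteq> {}"
  shows "half_plane_property I (posynomial I {B \<in> A. m B l = c} a m)"
  using assms(3-)
proof (induction c arbitrary: A a m)
  case 0
  then show ?case by (intro half_plane_posynomial_at_zero[OF I]) auto
next
  case (Suc c)
  define A' where "A' = {B \<in> A. m B l > 0}"
  define a' where "a' B = a B * m B l" for B
  define m' where "m' B = (m B)(l := m B l - 1)" for B
  have eq: "{B \<in> A'. m' B l = c} = {B \<in> A. m B l = Suc c}"
    by (auto simp: A'_def m'_def)
  have "half_plane_property I (posynomial I A' a' m')"
    unfolding A'_def a'_def[abs_def] m'_def[abs_def]
    using Suc.prems by (intro half_plane_posynomial_deriv[OF I]) auto
  then have hpp: "half_plane_property I (posynomial I {B \<in> A. m B l = Suc c} a' m')"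
    using Suc.IH[of A' a' m'] Suc.prems unfolding eq by (simp add: A'_def a'_def[abs_def])
  show ?case
    unfolding half_plane_property_def
  proof (intro allI impI)
    fix u :: "'a \<Rightarrow> complex" assume u: "\<forall>e\<in>I. Re (u e) > 0"
    have "posynomial I {B \<in> A. m B l = Suc c} a' m' u =
        of_nat (Suc c) / u l * posynomial I {B \<in> A. m B l = Suc c} a m u"
      unfolding posynomial_split[OF I] sum_distrib_left a'_def m'_def using u I
      by (intro sum.cong) auto
    then show "posynomial I {B \<in> A. m B l = Suc c} a m u \<noteq> 0"
      using half_plane_propertyD[OF hpp, of u] u by auto
  qed
qed

section \<open>Bases and blocks of the partition\<close>

text \<open>Each exchange replaces an element of \<open>A - B\<close> by one of
  \<open>B - A\<close>: the size of \<open>A\<close> is kept while \<open>A - B\<close> shrinks,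
  until \<open>A \<subseteq> B\<close>. Used in both directions, this makes the generating
  polynomial homogeneous.\<close>

lemma (in matroid) card_basis_le:
  assumes "A \<in> \<B>" "B \<in> \<B>"
  shows "card A \<le> card B"
  using assms
proof (induction "card (A - B)" arbitrary: A)
  case 0
  have fin: "finite A" "finite B"
    using 0 basis_subset finite_ground by (auto intro: finite_subset)
  then have "A \<subseteq> B" using 0 by auto
  then show ?case using fin by (simp add: card_mono)
next
  case (Suc n)
  have fin: "finite A" using Suc basis_subset finite_ground by (auto intro: finite_subset)
  obtain a where a: "a \<in> A - B" using Suc.hyps(2) by (metis card.empty ex_in_conv nat.distinct(1))
  then obtain b where b: "b \<in> B - A" "insert b (A - {a}) \<in> \<B>"
    using basis_exchange Suc.prems by blast
  have "insert b (A - {a}) - B = A - B - {a}" using b by auto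
  then have "card (insert b (A - {a})) \<le> card B"
    using Suc.hyps a b fin Suc.prems by (intro Suc.hyps(1)) auto
  moreover have "card (insert b (A - {a})) = card A"
    using a b fin card.remove[of A a] by (simp add: card_insert_if del: card_Diff_singleton)
  ultimately show ?case by simp
qed

lemma sum_card_Int_partition:
  assumes "finite E" "partition_on E P" "B \<subseteq> E"
  shows "(\<Sum>X\<in>P. card (B \<inter> X)) = card B"
proof -
  have "card (\<Union>X\<in>P. B \<inter> X) = (\<Sum>X\<in>P. card (B \<inter> X))"
    using assms finite_elements[OF assms(1,2)] partition_onD2[OF assms(2)]
    by (intro card_UN_disjoint) (auto simp: disjoint_def intro: finite_subset)
  moreover have "(\<Union>X\<in>P. B \<inter> X) = B"
    using assms partition_onD1[OF assms(2)] by auto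
  ultimately show ?thesis by simp
qed

text \<open>Substitute \<open>y e * u X\<close> for the variable of each \<open>e\<close> in block
  \<open>X\<close>; as \<open>y e > 0\<close>, this stays in the right half-plane.\<close>

lemma half_plane_block_posynomial:
  assumes fin: "finite E" and P: "partition_on E P" and sub: "\<And>B. B \<in> \<B> \<Longrightarrow> B \<subseteq> E"
    and hpp: "half_plane_property E (generating_poly \<B>)"
    and y: "\<And>e. e \<in> E \<Longrightarrow> y e > 0"
  shows "half_plane_property P (posynomial P \<B> (\<lambda>B. \<Prod>e\<in>B. y e) (\<lambda>B X. card (B \<inter> X)))"
  unfolding half_plane_property_def
proof (intro allI impI)
  fix u :: "'a set \<Rightarrow> complex" assume u: "\<forall>X\<in>P. Re (u X) > 0"
  define blk where "blk e = (THE X. X \<in> P \<and> e \<in> X)" for e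
  have blk: "blk e = X" if "X \<in> P" "e \<in> X" for e X
    unfolding blk_def using that partition_onD2[OF P]
    by (intro the_equality) (auto simp: disjoint_def)
  have "(\<Prod>e\<in>B. of_real (y e) * u (blk e)) =
      of_real (\<Prod>e\<in>B. y e) * (\<Prod>X\<in>P. u X ^ card (B \<inter> X))" if "B \<in> \<B>" for B
  proof -
    have finB: "finite B" using sub[OF that] fin by (rule finite_subset)
    have "(\<Prod>e\<in>B. u (blk e)) = (\<Prod>e\<in>(\<Union>X\<in>P. B \<inter> X). u (blk e))"
      using sub[OF that] partition_onD1[OF P] by (intro prod.cong) auto
    also have "\<dots> = (\<Prod>X\<in>P. \<Prod>e\<in>B \<inter> X. u (blk e))"
      using finite_elements[OF fin P] finB partition_onD2[OF P]
      by (intro prod.UNION_disjoint) (auto simp: disjoint_def)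
    also have "\<dots> = (\<Prod>X\<in>P. u X ^ card (B \<inter> X))"
      by (intro prod.cong refl) (simp add: blk)
    finally show ?thesis by (simp add: prod.distrib)
  qed
  then have "posynomial P \<B> (\<lambda>B. \<Prod>e\<in>B. y e) (\<lambda>B X. card (B \<inter> X)) u =
      generating_poly \<B> (\<lambda>e. of_real (y e) * u (blk e))"
    by (simp add: posynomial_def generating_poly_def)
  also have "\<dots> \<noteq> 0"
  proof (rule half_plane_propertyD[OF hpp])
    fix e assume e: "e \<in> E"
    then obtain X where "X \<in> P" "e \<in> X" using partition_onD1[OF P] by auto
    then show "Re (of_real (y e) * u (blk e)) > 0" using y[OF e] u blk by simp
  qed
  finally show "posynomial P \<B> (\<lambda>B. \<Prod>e\<in>B. y e) (\<lambda>B X. card (B \<inter> X)) u \<noteq> 0" .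
qed

section \<open>From the half-plane property to real zeros\<close>

lemma exists_rotation_half_plane:
  assumes "x \<notin> \<real>"
  obtains \<mu> :: complex where "Re \<mu> > 0" "Re (\<mu> * x) > 0"
proof -
  have im: "Im x \<noteq> 0" using assms complex_is_Real_iff by blast
  \<comment> \<open>With \<open>Re \<mu> = 1\<close>, requiring \<open>Re (\<mu> * x) = 1\<close>
    forces this imaginary part.\<close>
  have "Re (Complex 1 ((Re x - 1) / Im x) * x) = 1" using im by simp
  then show ?thesis using that[of "Complex 1 ((Re x - 1) / Im x)"] by simp
qed

theorem theorem4p5:
  fixes E S T :: "'a set" and \<B> :: "'a set set"
    and k :: nat and C :: "nat \<Rightarrow> 'a set" and c :: "nat \<Rightarrow> nat"
    and y :: "'a \<Rightarrow> real"
  assumes "matroid E \<B>"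
    and "ordered_partition E (S # T # map C [1..<k+1])"
    and "HPP_matroid E \<B>"
    and "\<And>e. e \<in> E \<Longrightarrow> y e > 0"
  shows "only_real_zeros (\<Sum>j=0..card S. monom (constrained_poly \<B> S k C c j y) j)"
proof -
  interpret matroid E \<B> by fact
  define P where "P = insert S (insert T (C ` {1..k}))"
  define a where "a B = (\<Prod>e\<in>B. y e)" for B
  define m where "m B X = card (B \<inter> X)" for B X :: "'a set"
  \<comment> \<open>Only the first \<open>i\<close> constraints are imposed, so that each induction
    step extracts one coefficient, in the variable of block \<open>C (Suc i)\<close>.\<close>
  define A where "A i = {B \<in> \<B>. \<forall>j\<in>{1..i}. m B (C j) = c j}" for i
  define p where "p = (\<Sum>j=0..card S. monom (constrained_poly \<B> S k C c j y) j)"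
  have "set (map C [1..<k+1]) = C ` {1..k}" by auto
  then have P: "partition_on E P" and ST: "S \<noteq> T" "S \<notin> C ` {1..k}" "T \<notin> C ` {1..k}"
    using assms(2) unfolding ordered_partition_def P_def by auto
  have finP: "finite P" using finite_elements[OF finite_ground P] .
  have fin\<B>: "finite \<B>"
    using basis_subset finite_ground by (intro finite_subset[of \<B> "Pow E"]) auto
  have a_pos: "a B > 0" if "B \<in> \<B>" for B
    unfolding a_def using assms(4) basis_subset[OF that] by (intro prod_pos) auto
  have hpp: "half_plane_property P (posynomial P (A i) a m)" if "i \<le> k" "A i \<noteq> {}" for i
    using that
  proof (induction i)
    case 0
    have "half_plane_property E (generating_poly \<B>)" using assms(3) by (simp add: HPP_matroid_def)
    then show ?case
      using half_plane_block_posynomial[OF finite_ground P basis_subset] assms(4)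
      unfolding A_def a_def[abs_def] m_def[abs_def] by simp
  next
    case (Suc i)
    have eq: "A (Suc i) = {B \<in> A i. m B (C (Suc i)) = c (Suc i)}"
      by (auto simp: A_def atLeastAtMostSuc_conv)
    show ?case
      unfolding eq
    proof (rule half_plane_posynomial_coeff)
      show "half_plane_property P (posynomial P (A i) a m)"
        using Suc eq by (intro Suc.IH) auto
    qed (use Suc.prems finP fin\<B> a_pos eq in \<open>auto simp: A_def P_def\<close>)
  qed
  have poly_p: "poly (map_poly complex_of_real p) x = (\<Sum>B\<in>A k. of_real (a B) * x ^ m B S)" for x
  proof -
    have finS: "finite S" using P finite_ground by (auto simp: P_def partition_on_def)
    have "finite (A k)" using fin\<B> by (simp add: A_def)
    \<comment> \<open>No basis meets \<open>S\<close> in more than \<open>card S\<close> elements,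
      so grouping by \<open>m B S\<close> over this range loses no term.\<close>
    have img: "(\<lambda>B. m B S) ` A k \<subseteq> {0..card S}"
      using finS by (auto simp: m_def card_mono)
    have "map_poly complex_of_real p =
        (\<Sum>j=0..card S. monom (of_real (constrained_poly \<B> S k C c j y)) j)"
      unfolding p_def
      by (rule poly_eqI) (simp add: coeff_map_poly coeff_sum coeff_monom if_distrib cong: if_cong)
    then have "poly (map_poly complex_of_real p) x =
        (\<Sum>j=0..card S. of_real (constrained_poly \<B> S k C c j y) * x ^ j)"
      by (simp add: poly_sum poly_monom)
    also have "\<dots> = (\<Sum>j=0..card S. \<Sum>B\<in>{B \<in> A k. m B S = j}. of_real (a B) * x ^ m B S)"
    proof (intro sum.cong refl)
      fix j
      have "{B \<in> \<B>. card (B \<inter> S) = j \<and> (\<forall>i\<in>{1..k}. card (B \<inter> C i) = c i)} = {B \<in> A k. m B S = j}"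
        by (auto simp: A_def m_def)
      then show "of_real (constrained_poly \<B> S k C c j y) * x ^ j =
          (\<Sum>B\<in>{B \<in> A k. m B S = j}. of_real (a B) * x ^ m B S)"
        unfolding constrained_poly_def generating_poly_def
        by (simp add: a_def sum_distrib_right)
    qed
    also have "\<dots> = (\<Sum>B\<in>A k. of_real (a B) * x ^ m B S)"
      by (intro sum.group \<open>finite (A k)\<close> img) simp
    finally show ?thesis .
  qed
  show ?thesis
    unfolding p_def[symmetric]
  proof (cases "A k = {}")
    case True
    then have "poly (map_poly complex_of_real p) x = 0" for x by (simp add: poly_p)
    then have "map_poly complex_of_real p = 0" using poly_all_0_iff_0 by blast
    then have "p = 0" by (simp add: poly_eq_iff coeff_map_poly)
    then show "only_real_zeros p" by (simp add: only_real_zeros_def)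
  next
    case False
    then obtain B\<^sub>0 where B0: "B\<^sub>0 \<in> A k" by auto
    \<comment> \<open>All bases have equal size and the counts in the \<open>C\<close>-blocks are
      prescribed, so \<open>d\<close> is the common degree in the variables of \<open>S\<close> and
      \<open>T\<close>.\<close>
    define d where "d = m B\<^sub>0 S + m B\<^sub>0 T"
    have d: "m B S + m B T = d" if "B \<in> A k" for B
    proof -
      have split: "m B S + m B T + (\<Sum>X\<in>C ` {1..k}. m B X) = card B" if "B \<in> A k" for B
        using sum_card_Int_partition[OF finite_ground P basis_subset, of B] that ST
        by (simp add: P_def A_def m_def)
      have "(\<Sum>X\<in>C ` {1..k}. m B X) = (\<Sum>X\<in>C ` {1..k}. m B\<^sub>0 X)"
        using that B0 by (intro sum.cong) (auto simp: A_def)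
      moreover have "card B = card B\<^sub>0"
        using card_basis_le[of B B\<^sub>0] card_basis_le[of B\<^sub>0 B] that B0 by (simp add: A_def)
      ultimately show ?thesis using split[OF that] split[OF B0] by (simp add: d_def)
    qed
    have "x \<in> \<real>" if zero: "poly (map_poly complex_of_real p) x = 0" for x
    proof (rule ccontr)
      assume "x \<notin> \<real>"
      then obtain \<mu> where \<mu>: "Re \<mu> > 0" "Re (\<mu> * x) > 0" by (rule exists_rotation_half_plane)
      \<comment> \<open>By homogeneity, evaluating here instead of at \<open>x\<close> for
        \<open>S\<close> and 1 for \<open>T\<close> only contributes the factor
        \<open>\<mu> ^ d\<close>, while every coordinate lies in the right half-plane.\<close>
      define u where "u X = (if X = S then \<mu> * x else if X = T then \<mu> else 1)" for X
      have "(\<Prod>X\<in>P. u X ^ m B X) = \<mu> ^ d * x ^ m B S" if "B \<in> A k" for B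
      proof -
        have "(\<Prod>X\<in>C ` {1..k}. u X ^ m B X) = 1"
          using ST by (intro prod.neutral) (auto simp: u_def)
        then have "(\<Prod>X\<in>P. u X ^ m B X) = (\<mu> * x) ^ m B S * \<mu> ^ m B T"
          using ST by (simp add: P_def u_def)
        then show ?thesis using d[OF that] by (simp add: power_mult_distrib power_add ac_simps flip: d[OF that])
      qed
      then have "posynomial P (A k) a m u = \<mu> ^ d * poly (map_poly complex_of_real p) x"
        by (simp add: posynomial_def poly_p sum_distrib_left ac_simps)
      moreover have "posynomial P (A k) a m u \<noteq> 0"
        using \<mu> by (intro half_plane_propertyD[OF hpp] False) (auto simp: u_def)
      ultimately show False using zero by simp
    qed
    then show "only_real_zeros p" by (auto simp: only_real_zeros_def)
  qed
qed

end
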